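(* In the Banach space setting described in the context (with the listed properties of $Q$, $G$, $\mathcal S$, $\mathcal R$), let $q^\dagger\in\mathcal B_\rho(q_0)$ be a solution of $F(q)=g$. Let $F$ be continuous with respect to $\tau_Q,\tau_G$ and satisfy $$(q_n\stackrel{\tau_Q}{\to}q\ \wedge\ \mathcal S(F(q_n),g)\to0)\ \Rightarrow\ (q\in\mathcal D(F)\ \wedge\ F(q)=g)\qquad\text{for all }(q_n)_{n\in\mathbb N}\subseteq Q,$$ and the generalized tangential cone condition $$\mathcal S\big(F(q),F(\bar q)+F'(q)(q-\bar q)\big)\le c_{tc}^2\,\mathcal S(F(q),F(\bar q))$$ for all $q,\bar q\in Q$ in a neighborhood of $q_0$, with $0<c_{tc}<1$ sufficiently small. Let, further, $\tau>0$ be chosen sufficiently large such that $$c_{\mathcal S}\Big(c_{\mathcal S}c_{tc}^2+\frac{1+c_{\mathcal S}c_{tc}^2}{\tau^2}\Big)<\tilde{\underline\theta}\quad\text{and}\quad 0<\frac{c_{\mathcal S}\tilde{\overline\theta}+c_{\mathcal S}^2c_{tc}^2}{1-c_{\mathcal S}^2c_{tc}^2}<1,$$ and let $\mathcal S(g,g^\delta)\le\delta^2$. Finally, let the discretization errors with respect to the quantities of interest satisfy $|I_{i,h}^k-I_i^k|\le\eta_i^k$, $i\in\{1,2,3,4\}$, where $\eta_1^k,\eta_2^k,\eta_3^k,\eta_4^k$ are selected such that $$\eta_1^k+c_{\mathcal S}^2c_{tc}^2\eta_3^k\le\Big(\tilde{\underline\theta}-c_{\mathcal S}\Big(c_{\mathcal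 S}c_{tc}^2+\frac{1+c_{\mathcal S}c_{tc}^2}{\tau^2}\Big)\Big)I_{3,h}^k,$$ $$\eta_3^k\le c_1I_{3,h}^k\quad\text{and}\quad\eta_2^k\to0,\ \eta_3^k\to0,\ \eta_4^k\to0\ \text{ as }k\to\infty,$$ $$I_{3,h}^k\le(1+c_3)I_{4,h}^{k-1}+r^k\quad\text{and}\quad(1+c_3)\frac{c_{\mathcal S}\tilde{\overline\theta}+c_{\mathcal S}^2c_{tc}^2}{1-c_{\mathcal S}^2c_{tc}^2}\le c_2<1$$ hold for some constants $c_1,c_2,c_3>0$ and a sequence $r^k\to0$ as $k\to\infty$ (the last condition on $c_2,c_3$ being possible due to the second condition on $\tilde{\overline\theta},c_{tc}$ above). Then, with $\beta_k$ and $h=h_k$ fulfilling $$\tilde{\underline\theta}\,I_{3,h}^k\le I_{2,h}^k\le\tilde{\overline\theta}\,I_{3,h}^k$$ and $k_*$ selected according to $k_*=\min\{k\in\mathbb N:I_{3,h}^k\le\tau^2\delta^2\}$, there holds: (i) For any solution $q^\dagger\in\mathcal B_\rho(q_0)$ of $F(q)=g$, $$\mathcal R(q_h^k)\le\mathcal R(q^\dagger)\qquad\forall k<k_*.$$ (ii) $k_*$ is finite. (iii) $q_{\mathrm{old}}^{k_*}=q_{h_{k_*-1}}^{k_*-1}$ converges (weakly) subsequentially to a solution of $F(q)=g$ as $\delta\to0$, in the sense that it has a $\tau_Q$-convergent subsequence and each $\tau_Q$-convergent subsequence converges to a solution of $F(q)=g$. If the solution $q^\dagger$ of $F(q)=g$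 is unique, then $q_{\mathrm{old}}^{k_*}$ converges with respect to $\tau_Q$ to $q^\dagger$ as $\delta\to0$.
   Context: Spaces and functionals. $Q$ and $G$ are Banach spaces with associated topologies $\tau_Q$ and $\tau_G$ that are weaker than the norm topologies. The data misfit $\mathcal S:G\times G\to\mathbb R$ and the regularization functional $\mathcal R:Q\to[0,+\infty]$, with domain $\mathcal D(\mathcal R)=\{q\in Q:\mathcal R(q)\neq\infty\}$, satisfy: - $y\mapsto\mathcal S(y,g^\delta)$ is convex and sequentially lower semicontinuous with respect to $\tau_G$; - $\mathcal S(y,\tilde y)=\mathcal S(\tilde y,y)$, $\mathcal S(y,\tilde y)\ge0$ and $\mathcal S(y,y)=0$ for all $y,\tilde y\in G$; - there is a constant $c_{\mathcal S}$ with $\mathcal S(y,\tilde y)\le c_{\mathcal S}(\mathcal S(y,\hat y)+\mathcal S(\hat y,\tilde y))$ for all $y,\tilde y,\hat y\in G$; - $\mathcal R$ is proper (its domain is non-empty), convex and $\tau_Q$-lower semicontinuous; - $\mathcal D:=\mathcal D(F)\cap\mathcal D(\mathcal R)\ne\emptyset$ is closed with respect to $\tau_Q$; - for every $C>0$ the set $\{q\in\mathcal D:\mathcal R(q)\le C\}$ is $\tau_Q$-sequentially compact in the sense that every sequence in it has a subsequence that is convergent in $Q$ with respect to $\tau_Q$. Operator. $F=C\circ S$, with domain $\mathcal D(F)\subseteq Q$ and values in $G$, where $C:V\to G$ is a measurement operator and $S:q\mapsto u\in V$ is the parameter-to-solution map of a (possibly nonlinear) PDE given in weak form with test space $W$;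 this PDE and its linearization are assumed uniquely and stably solvable. $F'(q)$ is the derivative of $F$ at $q$; for the $q_{\mathrm{old}}^k$ below, $F'(q_{\mathrm{old}}^k):Q\to G$ is continuous with respect to $\tau_Q$ and $\tau_G$. $g\in G$ is the exact data and $g^\delta\in G$ the noisy data. $\mathcal B_\rho(q_0)$ is the ball of radius $\rho>0$ around $q_0\in Q$, assumed to be contained in $\mathcal D(F)$. The constants $\tilde{\underline\theta},\tilde{\overline\theta}$ satisfy $0<\tilde{\underline\theta}\le\tilde{\overline\theta}<\frac12$. Discretization. $Q_h,V_h,W_h$ are finite element spaces for $Q,V,W$; $S_h$ is the discrete solution operator of the PDE (solution in $V_h$, test functions in $W_h$), and $F_h=C\circ S_h$ with derivative $F_h'$. The discretization may change from step to step; $h=h_k$ denotes the one in step $k$. Iteration. In step $k$, given $q_{\mathrm{old}}^k\in Q_{h_k}$ and $\beta_k>0$: the discrete iterate $q_h^k=q_{h_k}^k$ is a minimizer over $q\in Q_{h_k}$ of $\mathcal S(F_{h_k}'(q_{\mathrm{old}}^k)(q-q_{\mathrm{old}}^k)+F_{h_k}(q_{\mathrm{old}}^k),g^\delta)+\frac1{\beta_k}\mathcal R(q)$; the auxiliary continuous iterate $q^k$ is a minimizer over $q\in Q$ of $\mathcal S(F'(q_{\mathrm{old}}^k)(q-q_{\mathrm{old}}^k)+F(q_{\mathrm{old}}^k),g^\delta)+\frac1{\beta_k}\mathcal R(q)$; and one sets $q_{\mathrm{old}}^{k+1}:=q_{h_k}^k$. The dependence of all iterates on $\delta$ and $g^\delta$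 is suppressed in the notation. Quantities of interest. $I_1^k=\mathcal S(F'(q_{\mathrm{old}}^k)(q^k-q_{\mathrm{old}}^k)+F(q_{\mathrm{old}}^k),g^\delta)+\frac1{\beta_k}\mathcal R(q^k)$, $I_2^k=\mathcal S(F'(q_{\mathrm{old}}^k)(q^k-q_{\mathrm{old}}^k)+F(q_{\mathrm{old}}^k),g^\delta)$, $I_3^k=\mathcal S(F(q_{\mathrm{old}}^k),g^\delta)$, $I_4^k=\mathcal S(F(q^k),g^\delta)$; $I_{1,h}^k=\mathcal S(F_{h_k}'(q_{\mathrm{old}}^k)(q_{h_k}^k-q_{\mathrm{old}}^k)+F_{h_k}(q_{\mathrm{old}}^k),g^\delta)+\frac1{\beta_k}\mathcal R(q_{h_k}^k)$, $I_{2,h}^k=\mathcal S(F_{h_k}'(q_{\mathrm{old}}^k)(q_{h_k}^k-q_{\mathrm{old}}^k)+F_{h_k}(q_{\mathrm{old}}^k),g^\delta)$, $I_{3,h}^k=\mathcal S(F_{h_k}(q_{\mathrm{old}}^k),g^\delta)$, $I_{4,h}^k=\mathcal S(F_{h_k}(q_{h_k}^k),g^\delta)$.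
   Formalization: In the tangential cone condition the derivative is taken at q̄ instead of q; the iterates q_old^k and q^k are assumed to lie in the neighborhood, which contains B_ρ(q_0); R(q†)<∞ is assumed; if k_*=0 the starting value is assumed independent of δ. *)

theory Defs
  imports "HOL-Analysis.Analysis" "HOL-Library.Extended_Nat"
begin

definition weaker_topology :: "'a::topological_space topology \<Rightarrow> bool" where
  "weaker_topology T \<longleftrightarrow> topspace T = UNIV \<and> (\<forall>U. openin T U \<longrightarrow> open U)"

definition lsc_map :: "'a topology \<Rightarrow> ('a \<Rightarrow> ereal) \<Rightarrow> bool" where
  "lsc_map T f \<longleftrightarrow> (\<forall>c. openin T {x \<in> topspace T. c < f x})"

definition seq_lsc_map :: "'a topology \<Rightarrow> ('a \<Rightarrow> ereal) \<Rightarrow> bool" where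
  "seq_lsc_map T f \<longleftrightarrow>
     (\<forall>x l. limitin T x l sequentially \<longrightarrow> f l \<le> liminf (\<lambda>n. f (x n)))"

text \<open>The set \<open>Y\<close> collects the noisy data: convexity and lower semicontinuity are only required
  of the functionals \<open>S(\<cdot>, z)\<close> with \<open>z\<close> in \<open>Y\<close>.\<close>

definition data_misfit ::
  "'g::real_normed_vector topology \<Rightarrow> 'g set \<Rightarrow> real \<Rightarrow> ('g \<Rightarrow> 'g \<Rightarrow> real) \<Rightarrow> bool" where
  "data_misfit TG Y cS S \<longleftrightarrow>
     (\<forall>z\<in>Y. convex_on UNIV (\<lambda>y. S y z) \<and> seq_lsc_map TG (\<lambda>y. ereal (S y z))) \<and>
     (\<forall>y z. S y z = S z y) \<and>
     (\<forall>y z. 0 \<le> S y z) \<and>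
     (\<forall>y. S y y = 0) \<and>
     (\<forall>y z x. S y z \<le> cS * (S y x + S x z))"

text \<open>The last conjunct is the compactness of the level sets in the weak sense that the limit of
  the subsequence is only required to exist in the whole space.\<close>

definition regularization_functional ::
  "'q::real_normed_vector topology \<Rightarrow> 'q set \<Rightarrow> ('q \<Rightarrow> ereal) \<Rightarrow> bool" where
  "regularization_functional TQ DF R \<longleftrightarrow>
     (\<forall>q. 0 \<le> R q) \<and>
     (\<exists>q. R q \<noteq> \<infinity>) \<and>
     (\<forall>x y. \<forall>t\<in>{0..1}.
        R ((1 - t) *\<^sub>R x + t *\<^sub>R y) \<le> ereal (1 - t) * R x + ereal t * R y) \<and>
     lsc_map TQ R \<and>
     DF \<inter> {q. R q \<noteq> \<infinity>} \<noteq> {} \<and>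
     closedin TQ (DF \<inter> {q. R q \<noteq> \<infinity>}) \<and>
     (\<forall>C>0. \<forall>x :: nat \<Rightarrow> 'q.
        (\<forall>n. x n \<in> DF \<inter> {q. R q \<noteq> \<infinity>} \<and> R (x n) \<le> ereal C) \<longrightarrow>
        (\<exists>r p. strict_mono r \<and> limitin TQ (x \<circ> r) p sequentially))"

text \<open>The PDE is the equation \<open>A(q,u) = f\<close> in the dual of the test space. The same definitions
  with \<open>V\<close> and \<open>W\<close> finite dimensional describe its Galerkin discretization.\<close>

definition weak_solution ::
  "('q \<Rightarrow> 'v \<Rightarrow> ('w::real_normed_vector \<Rightarrow>\<^sub>L real)) \<Rightarrow> ('w \<Rightarrow>\<^sub>L real) \<Rightarrow>
   'v set \<Rightarrow> 'w set \<Rightarrow> 'q \<Rightarrow> 'v \<Rightarrow> bool" where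
  "weak_solution A f V W q u \<longleftrightarrow>
     u \<in> V \<and> (\<forall>w\<in>W. blinfun_apply (A q u) w = blinfun_apply f w)"

definition solution_operator ::
  "('q \<Rightarrow> 'v \<Rightarrow> ('w::real_normed_vector \<Rightarrow>\<^sub>L real)) \<Rightarrow> ('w \<Rightarrow>\<^sub>L real) \<Rightarrow>
   'v set \<Rightarrow> 'w set \<Rightarrow> 'q set \<Rightarrow> ('q \<Rightarrow> 'v) \<Rightarrow> bool" where
  "solution_operator A f V W D Sol \<longleftrightarrow>
     (\<forall>q\<in>D. \<forall>u. weak_solution A f V W q u \<longleftrightarrow> u = Sol q)"

definition stably_solvable_linearization ::
  "('q \<Rightarrow> 'v::real_normed_vector \<Rightarrow> ('w::real_normed_vector \<Rightarrow>\<^sub>L real)) \<Rightarrow>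
   'q set \<Rightarrow> ('q \<Rightarrow> 'v) \<Rightarrow> bool" where
  "stably_solvable_linearization A D Sol \<longleftrightarrow>
     (\<forall>q\<in>D. \<exists>L :: 'v \<Rightarrow>\<^sub>L ('w \<Rightarrow>\<^sub>L real).
        (A q has_derivative blinfun_apply L) (at (Sol q)) \<and>
        bij (blinfun_apply L) \<and>
        (\<exists>c. \<forall>v. norm v \<le> c * norm (blinfun_apply L v)))"

definition well_posed_pde ::
  "('q::real_normed_vector \<Rightarrow> 'v::real_normed_vector \<Rightarrow> ('w::real_normed_vector \<Rightarrow>\<^sub>L real)) \<Rightarrow>
   ('w \<Rightarrow>\<^sub>L real) \<Rightarrow> 'q set \<Rightarrow> ('q \<Rightarrow> 'v) \<Rightarrow> bool" where
  "well_posed_pde A f D Sol \<longleftrightarrow>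
     solution_operator A f UNIV UNIV D Sol \<and>
     continuous_on D Sol \<and>
     stably_solvable_linearization A D Sol"

definition finite_dim_subspace :: "'a::real_vector set \<Rightarrow> bool" where
  "finite_dim_subspace X \<longleftrightarrow> (\<exists>B. finite B \<and> X = span B)"

definition lin_misfit ::
  "('g \<Rightarrow> 'g \<Rightarrow> real) \<Rightarrow> ('q::real_normed_vector \<Rightarrow> 'g::real_normed_vector) \<Rightarrow>
   ('q \<Rightarrow> ('q \<Rightarrow>\<^sub>L 'g)) \<Rightarrow> 'g \<Rightarrow> 'q \<Rightarrow> 'q \<Rightarrow> real" where
  "lin_misfit S F F' z p q = S (blinfun_apply (F' p) (q - p) + F p) z"

definition tikhonov ::
  "('g \<Rightarrow> 'g \<Rightarrow> real) \<Rightarrow> ('q \<Rightarrow> ereal) \<Rightarrow>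
   ('q::real_normed_vector \<Rightarrow> 'g::real_normed_vector) \<Rightarrow> ('q \<Rightarrow> ('q \<Rightarrow>\<^sub>L 'g)) \<Rightarrow>
   real \<Rightarrow> 'g \<Rightarrow> 'q \<Rightarrow> 'q \<Rightarrow> ereal" where
  "tikhonov S R F F' \<beta> z p q = ereal (lin_misfit S F F' z p q) + ereal (1 / \<beta>) * R q"

text \<open>The linearization of \<open>F\<close> at \<open>p\<close> is compared with \<open>F\<close> at \<open>q\<close>. Evaluating the derivative at
  \<open>q\<close> instead of \<open>p\<close> gives the same condition for misfits that only depend on the
  difference of their arguments, but not in general.\<close>

definition tangential_cone ::
  "('g \<Rightarrow> 'g \<Rightarrow> real) \<Rightarrow> ('q::real_normed_vector \<Rightarrow> 'g::real_normed_vector) \<Rightarrow>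
   ('q \<Rightarrow> ('q \<Rightarrow>\<^sub>L 'g)) \<Rightarrow> real \<Rightarrow> 'q set \<Rightarrow> bool" where
  "tangential_cone S F F' c U \<longleftrightarrow>
     (\<forall>q\<in>U. \<forall>p\<in>U.
        S (F q) (F p + blinfun_apply (F' p) (q - p)) \<le> c\<^sup>2 * S (F q) (F p))"

lemma tangential_cone_translation_invariant:
  assumes sym: "\<And>y z. S y z = S z y"
    and inv: "\<And>y z w. S (y + w) (z + w) = S y z"
  shows "tangential_cone S F F' c U \<longleftrightarrow>
     (\<forall>q\<in>U. \<forall>p\<in>U.
        S (F q) (F p + blinfun_apply (F' q) (q - p)) \<le> c\<^sup>2 * S (F q) (F p))"
proof -
  have "S (F q) (F p + blinfun_apply (F' q) (q - p)) =
        S (F p) (F q + blinfun_apply (F' q) (p - q))" for q p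
    using inv[of "F p" "blinfun_apply (F' q) (q - p)" "F q + blinfun_apply (F' q) (p - q)"]
      sym[of "F q"]
    by (simp add: blinfun.diff_right)
  then show ?thesis
    unfolding tangential_cone_def using sym by metis
qed

end

theory Submission
  imports Defs
begin

text \<open>Comparing the continuous minimizer with an exact solution, and passing to the discrete one
  through the error bounds, cancels the residual terms in the Tikhonov functionals before stopping
  and leaves \<open>R q\<^sub>h \<le> R p\<close>. The tangential cone condition turns the choice of \<open>\<beta>\<close> into a linear
  contraction of the residuals \<open>I\<^sub>3\<^sub>h\<close> up to a vanishing perturbation, so they drop below any positive
  threshold. Convergence follows from compactness of the sublevel sets of \<open>R\<close>, since the misfit at
  the stopping index is \<open>O(\<delta>\<^sup>2)\<close>.\<close>

lemma data_misfit_sym: "data_misfit TG Y cS S \<Longrightarrow> S y z = S z y"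
  by (simp add: data_misfit_def)

lemma data_misfit_nonneg: "data_misfit TG Y cS S \<Longrightarrow> 0 \<le> S y z"
  by (simp add: data_misfit_def)

lemma data_misfit_triangle: "data_misfit TG Y cS S \<Longrightarrow> S y z \<le> cS * (S y x + S x z)"
  unfolding data_misfit_def by blast

text \<open>Taking \<open>z\<close> itself as intermediate point makes the second term of the
  quasi-triangle inequality vanish. A single positive misfit value therefore fixes the size, and in
  particular the sign, of \<open>cS\<close>.\<close>

lemma data_misfit_const_ge_1:
  assumes "data_misfit TG Y cS S" and "0 < S y z"
  shows "1 \<le> cS"
proof -
  have "S y z \<le> cS * (S y z + S z z)"
    using assms(1) by (rule data_misfit_triangle)
  moreover have "S z z = 0"
    using assms(1) by (simp add: data_misfit_def)
  ultimately show ?thesis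
    using assms(2) by simp
qed

text \<open>This form has a non-negative constant even when no positive misfit value is at hand, for
  instance for a run that stops at step 0.\<close>

lemma data_misfit_triangle_max:
  assumes "data_misfit TG Y cS S"
  shows "S y z \<le> max 1 cS * (S y x + S x z)"
proof -
  have "S y z \<le> cS * (S y x + S x z)"
    using assms by (rule data_misfit_triangle)
  also have "\<dots> \<le> max 1 cS * (S y x + S x z)"
    by (intro mult_right_mono add_nonneg_nonneg data_misfit_nonneg[OF assms]) simp
  finally show ?thesis .
qed

text \<open>The quasi-triangle inequality is used twice: from the linearization to \<open>z\<close>
  through \<open>F q\<close>, and from \<open>F q\<close> to \<open>F p\<close> through
  \<open>z\<close>, with the cone condition in between. It is meant for an exact solution
  \<open>q\<close>, noisy data \<open>z\<close> and \<open>d\<close> the squared noise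
  level.\<close>

lemma lin_misfit_solution_le:
  assumes S: "data_misfit TG Y cS S" and cS: "0 \<le> cS"
    and tcc: "tangential_cone S F F' c U" and "p \<in> U" "q \<in> U"
    and d: "S (F q) z \<le> d"
  shows "lin_misfit S F F' z p q \<le> cS * (cS * c\<^sup>2 * S (F p) z + (1 + cS * c\<^sup>2) * d)"
proof -
  let ?L = "F p + blinfun_apply (F' p) (q - p)"
  have "S ?L (F q) \<le> c\<^sup>2 * S (F q) (F p)"
    using tcc assms(4,5) data_misfit_sym[OF S, of ?L] by (simp add: tangential_cone_def)
  also have "S (F q) (F p) \<le> cS * (S (F q) z + S (F p) z)"
    using data_misfit_triangle[OF S] data_misfit_sym[OF S] by metis
  also have "\<dots> \<le> cS * (d + S (F p) z)"
    using d cS by (intro mult_left_mono) auto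
  finally have 1: "S ?L (F q) \<le> c\<^sup>2 * (cS * (d + S (F p) z))"
    by (simp add: mult_left_mono)
  have "S ?L z \<le> cS * (S ?L (F q) + S (F q) z)"
    by (rule data_misfit_triangle[OF S])
  also have "\<dots> \<le> cS * (c\<^sup>2 * (cS * (d + S (F p) z)) + d)"
    using 1 d cS by (intro mult_left_mono add_mono) auto
  finally show ?thesis
    by (simp add: lin_misfit_def algebra_simps)
qed

text \<open>Going from \<open>F q\<close> to \<open>z\<close> through the linearization and then
  splitting the cone term at \<open>z\<close> reproduces \<open>S (F q) z\<close> on the right,
  where it is absorbed into the left side. The division is left to the point where the factor is
  known to be positive.\<close>

lemma tangential_cone_residual_le:
  assumes S: "data_misfit TG Y cS S" and cS: "0 \<le> cS"
    and tcc: "tangential_cone S F F' c U" and "p \<in> U" "q \<in> U"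
  shows "(1 - cS\<^sup>2 * c\<^sup>2) * S (F q) z \<le> cS\<^sup>2 * c\<^sup>2 * S (F p) z + cS * lin_misfit S F F' z p q"
proof -
  let ?L = "F p + blinfun_apply (F' p) (q - p)"
  have "S (F q) ?L \<le> c\<^sup>2 * S (F q) (F p)"
    using tcc assms(4,5) by (simp add: tangential_cone_def)
  also have "S (F q) (F p) \<le> cS * (S (F q) z + S (F p) z)"
    using data_misfit_triangle[OF S] data_misfit_sym[OF S] by metis
  finally have 1: "S (F q) ?L \<le> c\<^sup>2 * (cS * (S (F q) z + S (F p) z))"
    by (simp add: mult_left_mono)
  have "S (F q) z \<le> cS * (S (F q) ?L + S ?L z)"
    by (rule data_misfit_triangle[OF S])
  also have "\<dots> \<le> cS * (c\<^sup>2 * (cS * (S (F q) z + S (F p) z)) + S ?L z)"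
    using 1 cS by (intro mult_left_mono add_mono) auto
  finally show ?thesis
    by (simp add: lin_misfit_def algebra_simps power2_eq_square)
qed

text \<open>Once \<open>e k\<close> is below \<open>(1 - c) * (m / 2)\<close>, the level
  \<open>m / 2\<close> reproduces itself under the recursion, because
  \<open>c * (m / 2) + (1 - c) * (m / 2) = m / 2\<close>. Any excess over that level decays
  geometrically.\<close>

lemma perturbed_contraction_LIMSEQ:
  fixes a e :: "nat \<Rightarrow> real"
  assumes a: "\<And>k. 0 \<le> a k" and c: "0 \<le> c" "c < 1"
    and step: "\<And>k. a (Suc k) \<le> c * a k + e k" and e: "e \<longlonglongrightarrow> 0"
  shows "a \<longlonglongrightarrow> 0"
proof (rule LIMSEQ_I)
  fix m :: real
  assume m: "0 < m"
  have "\<forall>\<^sub>F k in sequentially. e k < (1 - c) * (m / 2)"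
    using e m c by (intro order_tendstoD(2)) auto
  then obtain N where N: "\<And>k. N \<le> k \<Longrightarrow> e k < (1 - c) * (m / 2)"
    by (auto simp: eventually_sequentially)
  have bound: "a (N + n) \<le> c ^ n * a N + m / 2" for n
  proof (induction n)
    case 0
    then show ?case using m by simp
  next
    case (Suc n)
    have "a (N + Suc n) \<le> c * a (N + n) + (1 - c) * (m / 2)"
      using step[of "N + n"] N[of "N + n"] by simp
    also have "\<dots> \<le> c * (c ^ n * a N + m / 2) + (1 - c) * (m / 2)"
      using Suc c by (intro add_right_mono mult_left_mono) auto
    also have "\<dots> = c ^ Suc n * a N + m / 2"
      by (simp add: field_simps)
    finally show ?case .
  qed
  have "(\<lambda>n. c ^ n * a N) \<longlonglongrightarrow> 0"
    using c by (intro tendsto_mult_left_zero LIMSEQ_power_zero) auto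
  then have "\<forall>\<^sub>F n in sequentially. c ^ n * a N < m / 2"
    using m by (intro order_tendstoD(2)) auto
  then obtain M where M: "\<And>n. M \<le> n \<Longrightarrow> c ^ n * a N < m / 2"
    by (auto simp: eventually_sequentially)
  have "norm (a k - 0) < m" if "N + M \<le> k" for k
  proof -
    have "a k \<le> c ^ (k - N) * a N + m / 2" and "c ^ (k - N) * a N < m / 2"
      using bound[of "k - N"] M[of "k - N"] that by simp_all
    then have "a k < m" by linarith
    then show ?thesis using a[of k] by simp
  qed
  then show "\<exists>k0. \<forall>k\<ge>k0. norm (a k - 0) < m" by blast
qed

lemma Inf_enat_image_less: "enat k < Inf (enat ` K) \<Longrightarrow> k \<notin> K"
  using Inf_lower[of "enat k" "enat ` K"] by auto

text \<open>The empty set has infimum \<infinity>, so a finite infimum belongs to a non-empty set of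
  naturals and is attained by well-ordering.\<close>

lemma Inf_enat_image_mem:
  assumes "Inf (enat ` K) = enat k"
  shows "k \<in> K"
proof -
  obtain j where "j \<in> K"
    using assms by (cases "K = {}") (auto simp: Inf_enat_def)
  then have "Inf (enat ` K) \<in> enat ` K"
    by (auto simp: Inf_enat_def intro: LeastI)
  with assms show ?thesis by auto
qed

text \<open>This is the subsequence principle: if the limit failed, some sequence would stay outside
  a neighbourhood \<open>V\<close>, yet a subsequence of it has to enter \<open>V\<close>.
  Countability is asked of the domain only, so \<open>T\<close> may be any topology.\<close>

lemma limitin_at_within_if_subseq:
  fixes a :: "'a::first_countable_topology"
  assumes "l \<in> topspace T"
    and sub: "\<And>x. \<lbrakk>\<And>n. x n \<in> A; x \<longlonglongrightarrow> a\<rbrakk> \<Longrightarrow>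
      \<exists>s :: nat \<Rightarrow> nat. strict_mono s \<and> limitin T (\<lambda>n. h (x (s n))) l sequentially"
  shows "limitin T h l (at a within A)"
  unfolding limitin_def
proof (intro conjI allI impI, rule assms(1))
  fix V
  assume V: "openin T V \<and> l \<in> V"
  show "\<forall>\<^sub>F y in at a within A. h y \<in> V"
  proof (rule sequentially_imp_eventually_within, intro allI impI, rule ccontr)
    fix x :: "nat \<Rightarrow> 'a"
    assume x: "(\<forall>n. x n \<in> A \<and> x n \<noteq> a) \<and> x \<longlonglongrightarrow> a"
      and "\<not> (\<forall>\<^sub>F n in sequentially. h (x n) \<in> V)"
    then obtain t :: "nat \<Rightarrow> nat" where t: "strict_mono t" "\<And>n. h (x (t n)) \<notin> V"
      using not_eventually_sequentiallyD by blast
    have "(x \<circ> t) \<longlonglongrightarrow> a"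
      using x t(1) LIMSEQ_subseq_LIMSEQ by blast
    then obtain s :: "nat \<Rightarrow> nat" where "limitin T (\<lambda>n. h ((x \<circ> t) (s n))) l sequentially"
      using sub[of "x \<circ> t"] x by auto
    then have "\<forall>\<^sub>F n in sequentially. h ((x \<circ> t) (s n)) \<in> V"
      using V by (auto simp: limitin_def)
    then show False
      using t(2) by simp
  qed
qed

theorem theorem3:
  fixes TQ :: "'q::banach topology" and TG :: "'g::banach topology"
    and S :: "'g \<Rightarrow> 'g \<Rightarrow> real" and R :: "'q \<Rightarrow> ereal"
    and A :: "'q \<Rightarrow> 'v::banach \<Rightarrow> ('w::banach \<Rightarrow>\<^sub>L real)" and f :: "'w \<Rightarrow>\<^sub>L real"
    and Sol :: "'q \<Rightarrow> 'v" and Cm :: "'v \<Rightarrow> 'g"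
    and F :: "'q \<Rightarrow> 'g" and F' :: "'q \<Rightarrow> ('q \<Rightarrow>\<^sub>L 'g)" and DF U :: "'q set"
    and g :: 'g and q0 qdag qstart :: 'q
    and \<rho> cS ctc \<tau> \<theta>l \<theta>u c1 c2 c3 :: real
    \<comment> \<open>noise levels, and the quantities depending on the noise level and on the step\<close>
    and \<Delta> :: "real set" and gd :: "real \<Rightarrow> 'g"
    and Qh :: "real \<Rightarrow> nat \<Rightarrow> 'q set" and Vh :: "real \<Rightarrow> nat \<Rightarrow> 'v set"
    and Wh :: "real \<Rightarrow> nat \<Rightarrow> 'w set" and Sh :: "real \<Rightarrow> nat \<Rightarrow> 'q \<Rightarrow> 'v"
    and Fh :: "real \<Rightarrow> nat \<Rightarrow> 'q \<Rightarrow> 'g" and Fh' :: "real \<Rightarrow> nat \<Rightarrow> 'q \<Rightarrow> ('q \<Rightarrow>\<^sub>L 'g)"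
    and \<beta> :: "real \<Rightarrow> nat \<Rightarrow> real"
    and qold qh qc :: "real \<Rightarrow> nat \<Rightarrow> 'q"
    and I1 I1h :: "real \<Rightarrow> nat \<Rightarrow> ereal"
    and I2 I2h I3 I3h I4 I4h \<eta>1 \<eta>2 \<eta>3 \<eta>4 r :: "real \<Rightarrow> nat \<Rightarrow> real"
    and kstar :: "real \<Rightarrow> enat"
  \<comment> \<open>spaces and functionals\<close>
  assumes TQ: "weaker_topology TQ" and TG: "weaker_topology TG"
    and misfit: "data_misfit TG (gd ` \<Delta>) cS S"
    and regul: "regularization_functional TQ DF R"
  \<comment> \<open>forward operator and its derivative\<close>
    and pde: "well_posed_pde A f DF Sol"
    and F: "F = Cm \<circ> Sol"
    and F_cont: "continuous_map (subtopology TQ DF) TG F"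
    and F_seq: "\<And>x q. \<lbrakk>\<forall>n. x n \<in> DF; limitin TQ x q sequentially;
        (\<lambda>n. S (F (x n)) g) \<longlonglongrightarrow> 0\<rbrakk> \<Longrightarrow> q \<in> DF \<and> F q = g"
    and rho: "\<rho> > 0" "ball q0 \<rho> \<subseteq> DF"
    and U: "open U" "ball q0 \<rho> \<subseteq> U" "U \<subseteq> DF"
    and F': "\<And>q. q \<in> U \<Longrightarrow> (F has_derivative blinfun_apply (F' q)) (at q)"
    and tcc: "0 < ctc" "ctc < 1" "tangential_cone S F F' ctc U"
    and qdag: "qdag \<in> ball q0 \<rho>" "F qdag = g" "R qdag \<noteq> \<infinity>"
  \<comment> \<open>parameters and data\<close>
    and theta: "0 < \<theta>l" "\<theta>l \<le> \<theta>u" "\<theta>u < 1 / 2"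
    and tau: "\<tau> > 0"
    and small1: "cS * (cS * ctc\<^sup>2 + (1 + cS * ctc\<^sup>2) / \<tau>\<^sup>2) < \<theta>l"
    and small2: "0 < (cS * \<theta>u + cS\<^sup>2 * ctc\<^sup>2) / (1 - cS\<^sup>2 * ctc\<^sup>2)"
      "(cS * \<theta>u + cS\<^sup>2 * ctc\<^sup>2) / (1 - cS\<^sup>2 * ctc\<^sup>2) < 1"
    and c: "c1 > 0" "c2 > 0" "c3 > 0"
      "(1 + c3) * ((cS * \<theta>u + cS\<^sup>2 * ctc\<^sup>2) / (1 - cS\<^sup>2 * ctc\<^sup>2)) \<le> c2" "c2 < 1"
    and Delta: "\<Delta> \<subseteq> {0<..}"
    and noise: "\<And>\<delta>. \<delta> \<in> \<Delta> \<Longrightarrow> S g (gd \<delta>) \<le> \<delta>\<^sup>2"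
  \<comment> \<open>discretization\<close>
    and fe: "\<And>\<delta> k. \<delta> \<in> \<Delta> \<Longrightarrow> finite_dim_subspace (Qh \<delta> k) \<and>
        finite_dim_subspace (Vh \<delta> k) \<and> finite_dim_subspace (Wh \<delta> k)"
    and Sh: "\<And>\<delta> k. \<delta> \<in> \<Delta> \<Longrightarrow> solution_operator A f (Vh \<delta> k) (Wh \<delta> k) DF (Sh \<delta> k)"
    and Fh: "\<And>\<delta> k. Fh \<delta> k = Cm \<circ> Sh \<delta> k"
  \<comment> \<open>quantities of interest and stopping index (infinite if the set is empty)\<close>
    and I1: "\<And>\<delta> k. I1 \<delta> k = tikhonov S R F F' (\<beta> \<delta> k) (gd \<delta>) (qold \<delta> k) (qc \<delta> k)"
    and I2: "\<And>\<delta> k. I2 \<delta> k = lin_misfit S F F' (gd \<delta>) (qold \<delta> k) (qc \<delta> k)"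
    and I3: "\<And>\<delta> k. I3 \<delta> k = S (F (qold \<delta> k)) (gd \<delta>)"
    and I4: "\<And>\<delta> k. I4 \<delta> k = S (F (qc \<delta> k)) (gd \<delta>)"
    and I1h: "\<And>\<delta> k. I1h \<delta> k =
        tikhonov S R (Fh \<delta> k) (Fh' \<delta> k) (\<beta> \<delta> k) (gd \<delta>) (qold \<delta> k) (qh \<delta> k)"
    and I2h: "\<And>\<delta> k. I2h \<delta> k =
        lin_misfit S (Fh \<delta> k) (Fh' \<delta> k) (gd \<delta>) (qold \<delta> k) (qh \<delta> k)"
    and I3h: "\<And>\<delta> k. I3h \<delta> k = S (Fh \<delta> k (qold \<delta> k)) (gd \<delta>)"
    and I4h: "\<And>\<delta> k. I4h \<delta> k = S (Fh \<delta> k (qh \<delta> k)) (gd \<delta>)"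
    and kstar: "\<And>\<delta>. kstar \<delta> = Inf (enat ` {k. I3h \<delta> k \<le> \<tau>\<^sup>2 * \<delta>\<^sup>2})"
  \<comment> \<open>iteration up to the stopping index\<close>
    and start: "\<And>\<delta>. \<delta> \<in> \<Delta> \<Longrightarrow> kstar \<delta> = 0 \<Longrightarrow> qold \<delta> 0 = qstart"
    and qold: "\<And>\<delta> k. \<delta> \<in> \<Delta> \<Longrightarrow> enat k \<le> kstar \<delta> \<Longrightarrow> qold \<delta> k \<in> Qh \<delta> k \<inter> U"
    and F'_cont: "\<And>\<delta> k. \<delta> \<in> \<Delta> \<Longrightarrow> enat k < kstar \<delta> \<Longrightarrow>
        continuous_map TQ TG (blinfun_apply (F' (qold \<delta> k)))"
    and Fh': "\<And>\<delta> k. \<delta> \<in> \<Delta> \<Longrightarrow> enat k < kstar \<delta> \<Longrightarrow>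
        (Fh \<delta> k has_derivative blinfun_apply (Fh' \<delta> k (qold \<delta> k))) (at (qold \<delta> k))"
    and beta: "\<And>\<delta> k. \<delta> \<in> \<Delta> \<Longrightarrow> enat k < kstar \<delta> \<Longrightarrow> \<beta> \<delta> k > 0"
    and qh: "\<And>\<delta> k. \<delta> \<in> \<Delta> \<Longrightarrow> enat k < kstar \<delta> \<Longrightarrow>
        is_arg_min (tikhonov S R (Fh \<delta> k) (Fh' \<delta> k) (\<beta> \<delta> k) (gd \<delta>) (qold \<delta> k))
          (\<lambda>q. q \<in> Qh \<delta> k) (qh \<delta> k)"
    and qc: "\<And>\<delta> k. \<delta> \<in> \<Delta> \<Longrightarrow> enat k < kstar \<delta> \<Longrightarrow>
        is_arg_min (tikhonov S R F F' (\<beta> \<delta> k) (gd \<delta>) (qold \<delta> k)) (\<lambda>q. True) (qc \<delta> k)"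
    and qc_U: "\<And>\<delta> k. \<delta> \<in> \<Delta> \<Longrightarrow> enat k < kstar \<delta> \<Longrightarrow> qc \<delta> k \<in> U"
    and step: "\<And>\<delta> k. \<delta> \<in> \<Delta> \<Longrightarrow> enat k < kstar \<delta> \<Longrightarrow> qold \<delta> (Suc k) = qh \<delta> k"
  \<comment> \<open>discretization errors and choice of the regularization parameters\<close>
    and err: "\<And>\<delta> k. \<delta> \<in> \<Delta> \<Longrightarrow> enat k < kstar \<delta> \<Longrightarrow>
        \<bar>I1h \<delta> k - I1 \<delta> k\<bar> \<le> ereal (\<eta>1 \<delta> k) \<and>
        \<bar>I2h \<delta> k - I2 \<delta> k\<bar> \<le> \<eta>2 \<delta> k \<and> \<bar>I4h \<delta> k - I4 \<delta> k\<bar> \<le> \<eta>4 \<delta> k"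
    and err3: "\<And>\<delta> k. \<delta> \<in> \<Delta> \<Longrightarrow> enat k \<le> kstar \<delta> \<Longrightarrow> \<bar>I3h \<delta> k - I3 \<delta> k\<bar> \<le> \<eta>3 \<delta> k"
    and eta1: "\<And>\<delta> k. \<delta> \<in> \<Delta> \<Longrightarrow> enat k < kstar \<delta> \<Longrightarrow>
        \<eta>1 \<delta> k + cS\<^sup>2 * ctc\<^sup>2 * \<eta>3 \<delta> k
          \<le> (\<theta>l - cS * (cS * ctc\<^sup>2 + (1 + cS * ctc\<^sup>2) / \<tau>\<^sup>2)) * I3h \<delta> k"
    and eta3: "\<And>\<delta> k. \<delta> \<in> \<Delta> \<Longrightarrow> enat k \<le> kstar \<delta> \<Longrightarrow> \<eta>3 \<delta> k \<le> c1 * I3h \<delta> k"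
    and eta_lim: "\<And>\<delta>. \<delta> \<in> \<Delta> \<Longrightarrow> \<eta>2 \<delta> \<longlonglongrightarrow> 0 \<and> \<eta>3 \<delta> \<longlonglongrightarrow> 0 \<and> \<eta>4 \<delta> \<longlonglongrightarrow> 0"
    and I34: "\<And>\<delta> k. \<delta> \<in> \<Delta> \<Longrightarrow> enat k < kstar \<delta> \<Longrightarrow>
        I3h \<delta> (Suc k) \<le> (1 + c3) * I4h \<delta> k + r \<delta> (Suc k)"
    and r: "\<And>\<delta>. \<delta> \<in> \<Delta> \<Longrightarrow> r \<delta> \<longlonglongrightarrow> 0"
    and choice: "\<And>\<delta> k. \<delta> \<in> \<Delta> \<Longrightarrow> enat k < kstar \<delta> \<Longrightarrow>
        \<theta>l * I3h \<delta> k \<le> I2h \<delta> k \<and> I2h \<delta> k \<le> \<theta>u * I3h \<delta> k"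
  shows "(\<forall>\<delta>\<in>\<Delta>. \<forall>p\<in>ball q0 \<rho>. F p = g \<longrightarrow>
            (\<forall>k. enat k < kstar \<delta> \<longrightarrow> R (qh \<delta> k) \<le> R p))
    \<and> (\<forall>\<delta>\<in>\<Delta>. kstar \<delta> \<noteq> \<infinity>)
    \<and> (\<forall>d :: nat \<Rightarrow> real. (\<forall>n. d n \<in> \<Delta>) \<and> d \<longlonglongrightarrow> 0 \<longrightarrow>
          (\<exists>s p. strict_mono s \<and>
             limitin TQ (\<lambda>n. qold (d (s n)) (the_enat (kstar (d (s n))))) p sequentially) \<and>
          (\<forall>s p. strict_mono s \<and>
             limitin TQ (\<lambda>n. qold (d (s n)) (the_enat (kstar (d (s n))))) p sequentially \<longrightarrow>
             p \<in> DF \<and> F p = g))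
    \<and> ((\<forall>p\<in>DF. F p = g \<longrightarrow> p = qdag) \<longrightarrow>
          limitin TQ (\<lambda>\<delta>. qold \<delta> (the_enat (kstar \<delta>))) qdag (at 0 within \<Delta>))"
proof -

  \<comment> \<open>Residuals before and at the stopping index\<close>
  note S_nonneg = data_misfit_nonneg[OF misfit]
  \<comment> \<open>The factor by which one step reduces the residual, up to discretization errors
    and the factor \<open>1 + c3\<close>.\<close>
  define L where "L = (cS * \<theta>u + cS\<^sup>2 * ctc\<^sup>2) / (1 - cS\<^sup>2 * ctc\<^sup>2)"
  define qstop where "qstop \<delta> = qold \<delta> (the_enat (kstar \<delta>))" for \<delta>
  have top: "topspace TQ = UNIV"
    using TQ by (simp add: weaker_topology_def)
  have R_nonneg: "0 \<le> R q" for q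
    using regul by (simp add: regularization_functional_def)
  have running: "\<tau>\<^sup>2 * \<delta>\<^sup>2 < I3h \<delta> k" if "enat k < kstar \<delta>" for \<delta> k
    using that kstar[of \<delta>] Inf_enat_image_less[of k "{k. I3h \<delta> k \<le> \<tau>\<^sup>2 * \<delta>\<^sup>2}"] by auto
  have stopped: "I3h \<delta> k \<le> \<tau>\<^sup>2 * \<delta>\<^sup>2" if "kstar \<delta> = enat k" for \<delta> k
    using that kstar[of \<delta>] Inf_enat_image_mem[of "{k. I3h \<delta> k \<le> \<tau>\<^sup>2 * \<delta>\<^sup>2}" k] by auto
  \<comment> \<open>Before stopping the residual exceeds
    \<open>\<tau>\<^sup>2 * \<delta>\<^sup>2\<close> and is thus a positive misfit value.\<close>
  have cS: "1 \<le> cS" if "enat k < kstar \<delta>" for \<delta> k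
  proof (rule data_misfit_const_ge_1[OF misfit])
    have "0 \<le> \<tau>\<^sup>2 * \<delta>\<^sup>2" by simp
    then show "0 < S (Fh \<delta> k (qold \<delta> k)) (gd \<delta>)"
      using running[OF that] I3h[of \<delta> k] by linarith
  qed
  have qold_U: "qold \<delta> k \<in> U" if "\<delta> \<in> \<Delta>" "enat k \<le> kstar \<delta>" for \<delta> k
    using qold[OF that] by simp

  \<comment> \<open>Monotonicity: the regularization functional stays below its value at any
    solution\<close>
  have R_bound: "R (qh \<delta> k) \<le> R p"
    if \<delta>: "\<delta> \<in> \<Delta>" and k: "enat k < kstar \<delta>" and p: "p \<in> ball q0 \<rho>" "F p = g" for \<delta> k p
  proof (cases "R p = \<infinity>")
    \<comment> \<open>Finiteness of \<open>R\<close> is assumed at \<open>qdag\<close> only; for a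
      solution with \<open>R p = \<infinity>\<close> the bound is trivial.\<close>
    case False
    then obtain Rp where Rp: "R p = ereal Rp"
      using R_nonneg[of p] by (cases "R p") auto
    have b: "0 < \<beta> \<delta> k" using beta[OF \<delta> k] .
    have cS0: "0 \<le> cS" using cS[OF k] by simp
    have kle: "enat k \<le> kstar \<delta>" using k by simp
    define lp where "lp = lin_misfit S F F' (gd \<delta>) (qold \<delta> k) p"
    \<comment> \<open>The solution \<open>p\<close> need not lie in the finite element space, so it
      competes with the continuous minimizer, and the bound on \<open>I1h - I1\<close> carries the
      comparison over to \<open>qh\<close>.\<close>
    have "I1 \<delta> k \<le> tikhonov S R F F' (\<beta> \<delta> k) (gd \<delta>) (qold \<delta> k) p"
      using qc[OF \<delta> k] by (simp add: I1 is_arg_min_linorder)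
    also have "\<dots> = ereal (lp + Rp / \<beta> \<delta> k)"
      by (simp add: tikhonov_def lp_def Rp)
    finally have I1_le: "I1 \<delta> k \<le> ereal (lp + Rp / \<beta> \<delta> k)" .
    have "0 \<le> ereal (1 / \<beta> \<delta> k) * R (qc \<delta> k)"
      using b R_nonneg by simp
    then have "0 \<le> I1 \<delta> k"
      unfolding I1 tikhonov_def lin_misfit_def by (intro add_nonneg_nonneg) (simp_all add: S_nonneg)
    with I1_le obtain i1 where i1: "I1 \<delta> k = ereal i1"
      by (cases "I1 \<delta> k") auto
    \<comment> \<open>An infinite \<open>R (qh \<delta> k)\<close> would make \<open>I1h\<close>
      infinite while \<open>I1\<close> is finite, against the real error bound.\<close>
    obtain Rq where Rq: "R (qh \<delta> k) = ereal Rq"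
    proof (cases "R (qh \<delta> k)")
      case PInf
      then have "I1h \<delta> k = \<infinity>"
        using b by (simp add: I1h tikhonov_def)
      then show ?thesis
        using err[OF \<delta> k] i1 by simp
    qed (use R_nonneg[of "qh \<delta> k"] in auto)
    have "I1h \<delta> k = ereal (I2h \<delta> k + Rq / \<beta> \<delta> k)"
      by (simp add: I1h I2h tikhonov_def Rq)
    then have "I2h \<delta> k + Rq / \<beta> \<delta> k \<le> i1 + \<eta>1 \<delta> k"
      using err[OF \<delta> k] i1 by (simp add: abs_le_iff)
    \<comment> \<open>It remains to show
      \<open>lp + \<eta>1 \<delta> k \<le> I2h \<delta> k\<close>: the misfit terms then cancel and
      the terms with \<open>R\<close> are left.\<close>
    then have upper: "I2h \<delta> k + Rq / \<beta> \<delta> k \<le> lp + Rp / \<beta> \<delta> k + \<eta>1 \<delta> k"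
      using I1_le i1 by simp
    have "lp \<le> cS * (cS * ctc\<^sup>2 * I3 \<delta> k + (1 + cS * ctc\<^sup>2) * \<delta>\<^sup>2)"
      unfolding lp_def I3 using noise[OF \<delta>] p U(2) qold_U[OF \<delta> kle]
      by (intro lin_misfit_solution_le[OF misfit cS0 tcc(3)]) auto
    \<comment> \<open>Before stopping, the noise is dominated by the residual:
      \<open>\<delta>\<^sup>2 < I3h \<delta> k / \<tau>\<^sup>2\<close>. The bound then involves
      only \<open>I3h\<close> and \<open>\<eta>3\<close>, as in the condition on
      \<open>\<eta>1\<close>.\<close>
    also have "\<dots> \<le> cS * (cS * ctc\<^sup>2 * (I3h \<delta> k + \<eta>3 \<delta> k) + (1 + cS * ctc\<^sup>2) * (I3h \<delta> k / \<tau>\<^sup>2))"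
    proof (intro mult_left_mono add_mono)
      show "I3 \<delta> k \<le> I3h \<delta> k + \<eta>3 \<delta> k"
        using err3[OF \<delta> kle] by linarith
      show "\<delta>\<^sup>2 \<le> I3h \<delta> k / \<tau>\<^sup>2"
        using running[OF k] tau by (simp add: field_simps)
    qed (use cS0 in auto)
    also have "\<dots> = cS * (cS * ctc\<^sup>2 + (1 + cS * ctc\<^sup>2) / \<tau>\<^sup>2) * I3h \<delta> k + cS\<^sup>2 * ctc\<^sup>2 * \<eta>3 \<delta> k"
      by (simp add: field_simps power2_eq_square)
    also have "\<dots> \<le> \<theta>l * I3h \<delta> k - \<eta>1 \<delta> k"
      using eta1[OF \<delta> k] by (simp add: left_diff_distrib)
    also have "\<dots> \<le> I2h \<delta> k - \<eta>1 \<delta> k"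
      using choice[OF \<delta> k] by simp
    finally have "Rq / \<beta> \<delta> k \<le> Rp / \<beta> \<delta> k"
      using upper by linarith
    then show ?thesis
      using b by (simp add: Rp Rq divide_le_cancel)
  qed simp

  \<comment> \<open>Finiteness of the stopping index by contraction of the residuals\<close>
  have finite_stop: "kstar \<delta> \<noteq> \<infinity>" if \<delta>: "\<delta> \<in> \<Delta>" for \<delta>
  proof
    assume "kstar \<delta> = \<infinity>"
    then have k: "enat k < kstar \<delta>" and kle: "enat k \<le> kstar \<delta>" for k by simp_all
    define D where "D = 1 - cS\<^sup>2 * ctc\<^sup>2"
    \<comment> \<open>All error terms of one step. The shift in \<open>r \<delta> (Suc k)\<close>
      comes from bounding the next residual by the current \<open>I4h\<close>.\<close>
    define e where
      "e k = (1 + c3) * ((cS\<^sup>2 * ctc\<^sup>2 * \<eta>3 \<delta> k + cS * \<eta>2 \<delta> k) / D + \<eta>4 \<delta> k) + r \<delta> (Suc k)" for k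
    have cS1: "1 \<le> cS" using cS[OF k[of 0]] .
    \<comment> \<open>With a positive numerator, positivity of the quotient in \<open>small2\<close>
      forces the denominator \<open>D\<close> to be positive.\<close>
    have "0 < cS * \<theta>u + cS\<^sup>2 * ctc\<^sup>2"
      using cS1 theta by (intro add_pos_nonneg mult_pos_pos) auto
    then have D: "0 < D"
      using small2(1) by (auto simp: zero_less_divide_iff D_def)
    have I4_le: "I4 \<delta> k \<le> L * I3h \<delta> k + (cS\<^sup>2 * ctc\<^sup>2 * \<eta>3 \<delta> k + cS * \<eta>2 \<delta> k) / D" for k
    proof -
      have "D * I4 \<delta> k \<le> cS\<^sup>2 * ctc\<^sup>2 * I3 \<delta> k + cS * I2 \<delta> k"
        unfolding D_def I4 I3 I2
        using cS1 qold_U[OF \<delta> kle] qc_U[OF \<delta> k]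
        by (intro tangential_cone_residual_le[OF misfit _ tcc(3)]) auto
      also have "\<dots> \<le> cS\<^sup>2 * ctc\<^sup>2 * (I3h \<delta> k + \<eta>3 \<delta> k) + cS * (\<theta>u * I3h \<delta> k + \<eta>2 \<delta> k)"
      proof (intro mult_left_mono add_mono)
        show "I3 \<delta> k \<le> I3h \<delta> k + \<eta>3 \<delta> k"
          using err3[OF \<delta> kle[of k]] by linarith
        show "I2 \<delta> k \<le> \<theta>u * I3h \<delta> k + \<eta>2 \<delta> k"
          using err[OF \<delta> k[of k]] choice[OF \<delta> k[of k]] by linarith
      qed (use cS1 in auto)
      also have "\<dots> = D * (L * I3h \<delta> k + (cS\<^sup>2 * ctc\<^sup>2 * \<eta>3 \<delta> k + cS * \<eta>2 \<delta> k) / D)"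
        using D unfolding L_def D_def[symmetric] by (simp add: field_simps)
      finally show ?thesis
        using D by simp
    qed
    have "I3h \<delta> (Suc k) \<le> c2 * I3h \<delta> k + e k" for k
    proof -
      have "I4h \<delta> k \<le> I4 \<delta> k + \<eta>4 \<delta> k"
        using err[OF \<delta> k[of k]] by linarith
      also have "\<dots> \<le> L * I3h \<delta> k + (cS\<^sup>2 * ctc\<^sup>2 * \<eta>3 \<delta> k + cS * \<eta>2 \<delta> k) / D + \<eta>4 \<delta> k"
        using I4_le[of k] by simp
      finally have "(1 + c3) * I4h \<delta> k
          \<le> (1 + c3) * (L * I3h \<delta> k + (cS\<^sup>2 * ctc\<^sup>2 * \<eta>3 \<delta> k + cS * \<eta>2 \<delta> k) / D + \<eta>4 \<delta> k)"
        using c(3) by (intro mult_left_mono) auto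
      then have "I3h \<delta> (Suc k) \<le> ((1 + c3) * L) * I3h \<delta> k + e k"
        using I34[OF \<delta> k[of k]] by (simp add: e_def algebra_simps)
      also have "((1 + c3) * L) * I3h \<delta> k \<le> c2 * I3h \<delta> k"
        using c(4) by (intro mult_right_mono) (auto simp: L_def I3h S_nonneg)
      finally show ?thesis by simp
    qed
    moreover have "e \<longlonglongrightarrow> 0"
    proof -
      have "e \<longlonglongrightarrow> (1 + c3) * ((cS\<^sup>2 * ctc\<^sup>2 * 0 + cS * 0) / D + 0) + 0"
        unfolding e_def using eta_lim[OF \<delta>] LIMSEQ_Suc[OF r[OF \<delta>]] D
        by (intro tendsto_intros) auto
      then show ?thesis by simp
    qed
    ultimately have "I3h \<delta> \<longlonglongrightarrow> 0"
      using c by (intro perturbed_contraction_LIMSEQ[of "I3h \<delta>" c2 e]) (auto simp: I3h S_nonneg)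
    \<comment> \<open>Without stopping, every residual exceeds the threshold, so their limit 0
      cannot lie below it.\<close>
    then have "\<tau>\<^sup>2 * \<delta>\<^sup>2 \<le> 0"
      by (rule LIMSEQ_le_const) (use running[OF k] in \<open>auto intro: less_imp_le\<close>)
    moreover have "0 < \<tau>\<^sup>2 * \<delta>\<^sup>2"
      using tau \<delta> Delta by auto
    ultimately show False by simp
  qed

  \<comment> \<open>Subsequential convergence of the stopped iterates\<close>
  have qstop_U: "qstop \<delta> \<in> U" if "\<delta> \<in> \<Delta>" for \<delta>
    using finite_stop[OF that] by (auto simp: qstop_def intro: qold_U[OF that])
  then have qstop_DF: "qstop \<delta> \<in> DF" if "\<delta> \<in> \<Delta>" for \<delta>
    using that U(3) by blast
  \<comment> \<open>The stopped iterate is the discrete minimizer of the preceding step, hence the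
    bound at \<open>k\<close> with \<open>kstar \<delta> = Suc k\<close>. For
    \<open>kstar \<delta> = 0\<close> it is the starting value, about which (i) says
    nothing.\<close>
  have qstop_R: "R (qstop \<delta>) \<le> R qdag" if \<delta>: "\<delta> \<in> \<Delta>" and pos: "kstar \<delta> \<noteq> 0" for \<delta>
  proof -
    obtain k where k: "kstar \<delta> = enat (Suc k)"
      using finite_stop[OF \<delta>] pos by (metis not_infinity_eq not0_implies_Suc zero_enat_def)
    then have "qstop \<delta> = qh \<delta> k"
      using step[OF \<delta>, of k] by (simp add: qstop_def)
    then show ?thesis
      using R_bound[OF \<delta> _ qdag(1,2), of k] k by simp
  qed
  \<comment> \<open>\<open>(1 + c1) * \<tau>\<^sup>2\<close> bounds the exact residual by the
    discrete one at stopping, through \<open>\<eta>3 \<delta> k \<le> c1 * I3h \<delta> k\<close>;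
    the summand 1 is the noise.\<close>
  define K where "K = max 1 cS * ((1 + c1) * \<tau>\<^sup>2 + 1)"
  have residual: "S (F (qstop \<delta>)) g \<le> K * \<delta>\<^sup>2" if \<delta>: "\<delta> \<in> \<Delta>" for \<delta>
  proof -
    obtain k where k: "kstar \<delta> = enat k"
      using finite_stop[OF \<delta>] by auto
    have "I3 \<delta> k \<le> (1 + c1) * I3h \<delta> k"
      using err3[OF \<delta>, of k] eta3[OF \<delta>, of k] k by (simp add: algebra_simps)
    also have "\<dots> \<le> (1 + c1) * (\<tau>\<^sup>2 * \<delta>\<^sup>2)"
      using stopped[OF k] c(1) by (intro mult_left_mono) auto
    finally have 1: "S (F (qstop \<delta>)) (gd \<delta>) \<le> (1 + c1) * (\<tau>\<^sup>2 * \<delta>\<^sup>2)"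
      by (simp add: I3 qstop_def k)
    have "S (F (qstop \<delta>)) g \<le> max 1 cS * (S (F (qstop \<delta>)) (gd \<delta>) + S (gd \<delta>) g)"
      by (rule data_misfit_triangle_max[OF misfit])
    also have "\<dots> \<le> max 1 cS * ((1 + c1) * (\<tau>\<^sup>2 * \<delta>\<^sup>2) + \<delta>\<^sup>2)"
      using 1 noise[OF \<delta>] data_misfit_sym[OF misfit, of g]
      by (intro mult_left_mono add_mono) auto
    finally show ?thesis by (simp add: K_def algebra_simps)
  qed

  have subseq: "\<exists>s p. strict_mono s \<and> limitin TQ (\<lambda>n. qstop (d (s n))) p sequentially"
    if d: "\<And>n. d n \<in> \<Delta>" for d :: "nat \<Rightarrow> real"
  proof (cases "\<forall>\<^sub>F n in sequentially. kstar (d n) \<noteq> 0")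
    case True
    then obtain N where N: "\<And>n. N \<le> n \<Longrightarrow> kstar (d n) \<noteq> 0"
      by (auto simp: eventually_sequentially)
    obtain Rd where Rd: "R qdag = ereal Rd"
      using qdag(3) R_nonneg[of qdag] by (cases "R qdag") auto
    \<comment> \<open>Compactness is assumed for positive levels only and \<open>R qdag\<close> may
      be 0, so the level is raised by 1.\<close>
    have Rd_pos: "0 < Rd + 1"
      using R_nonneg[of qdag] Rd by simp
    have "R (qstop (d (n + N))) \<le> ereal (Rd + 1)" for n
      using qstop_R[OF d N, of "n + N"] order_trans by (fastforce simp: Rd)
    then have "\<forall>n. qstop (d (n + N)) \<in> DF \<inter> {q. R q \<noteq> \<infinity>} \<and> R (qstop (d (n + N))) \<le> ereal (Rd + 1)"
      using qstop_DF[OF d] by (metis IntI PInfty_neq_ereal(1) ereal_infty_less_eq(1) mem_Collect_eq)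
    then obtain t p where "strict_mono t"
        "limitin TQ ((\<lambda>n. qstop (d (n + N))) \<circ> t) p sequentially"
      using regul Rd_pos unfolding regularization_functional_def by meson
    then show ?thesis
      by (intro exI[of _ "\<lambda>n. t n + N"] exI[of _ p]) (auto simp: strict_mono_def o_def)
  next
    case False
    \<comment> \<open>If infinitely many runs stop at once, they all return \<open>qstart\<close>,
      which does not depend on the noise level, and this constant subsequence converges.\<close>
    then obtain t :: "nat \<Rightarrow> nat" where t: "strict_mono t" "\<And>n. kstar (d (t n)) = 0"
      using not_eventually_sequentiallyD by blast
    have "qstop (d (t n)) = qstart" for n
      using start[OF d t(2)] t(2) by (simp add: qstop_def zero_enat_def)
    then show ?thesis
      using t(1) top by (intro exI[of _ t] exI[of _ qstart]) simp
  qed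

  have limit: "p \<in> DF \<and> F p = g"
    if d: "\<And>n. d n \<in> \<Delta>" "d \<longlonglongrightarrow> 0" and p: "limitin TQ (\<lambda>n. qstop (d n)) p sequentially"
    for d :: "nat \<Rightarrow> real" and p
  proof (rule F_seq[OF _ p])
    have "(\<lambda>n. K * (d n)\<^sup>2) \<longlonglongrightarrow> K * 0\<^sup>2"
      using d(2) by (intro tendsto_intros)
    then have K0: "(\<lambda>n. K * (d n)\<^sup>2) \<longlonglongrightarrow> 0" by simp
    show "(\<lambda>n. S (F (qstop (d n))) g) \<longlonglongrightarrow> 0"
      by (rule tendsto_sandwich[OF _ _ tendsto_const K0]) (auto simp: S_nonneg residual d(1))
  qed (use qstop_DF d in auto)

  have limit_subseq: "p \<in> DF \<and> F p = g"
    if "\<And>n. d n \<in> \<Delta>" "d \<longlonglongrightarrow> 0" "strict_mono s"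
      "limitin TQ (\<lambda>n. qstop (d (s n))) p sequentially" for d :: "nat \<Rightarrow> real" and s p
    using limit[of "d \<circ> s" p] LIMSEQ_subseq_LIMSEQ[OF that(2,3)] that(1,4) by simp

  \<comment> \<open>With a unique solution all subsequential limits equal \<open>qdag\<close>, so
    the subsequence principle yields convergence of the whole family.\<close>
  have "limitin TQ qstop qdag (at 0 within \<Delta>)" if uniq: "\<forall>p\<in>DF. F p = g \<longrightarrow> p = qdag"
  proof (rule limitin_at_within_if_subseq)
    fix d :: "nat \<Rightarrow> real"
    assume d: "\<And>n. d n \<in> \<Delta>" "d \<longlonglongrightarrow> 0"
    obtain s p where "strict_mono s" "limitin TQ (\<lambda>n. qstop (d (s n))) p sequentially"
      using subseq[of d] d(1) by blast
    then show "\<exists>s. strict_mono s \<and> limitin TQ (\<lambda>n. qstop (d (s n))) qdag sequentially"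
      using limit_subseq[of d s p] d uniq by blast
  qed (simp add: top)
  then show ?thesis
    using R_bound finite_stop subseq limit_subseq unfolding qstop_def by blast
qed

end
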